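(* Let $n\ge 2$. Let $\alpha_S,\alpha_L,\beta_E$ be nonnegative integers with $\alpha_S+\alpha_L>0$, and put $\beta_D=2(\alpha_S+\alpha_L)-1$. Let $W_s$ be a word over the alphabet $\{D,E\}$ with exactly $\beta_D$ letters $D$ and $\beta_E$ letters $E$, and let $W_c$ be a word over $\{S,L\}$ with exactly $\alpha_S$ letters $S$ and $\alpha_L$ letters $L$. Suppose $2\beta_E+3\alpha_S+4\alpha_L=n+1$ (i.e., $(W_s,W_c)$ is a feasible pair). Then the pair defines a ticker tape: there is an independent set of $\mathcal{C}_n$ whose ticker tape has slither $W_s$ and co-slither $W_c$ (as words up to cyclic shift).
   Context: Let $\mathcal{C}_n$ be the cycle graph with vertex set $\mathbb{Z}_n=\{1,\dots,n\}$ and edges $\{i,i+1\}$ (indices mod $n$, so $\{n,1\}$ is an edge). An independent set is written as a binary vector $x=(x_1,\dots,x_n)\in\{0,1\}^n$ with no two cyclically adjacent entries equal to $1$. For $k\in[n]$, the toggle $\tau_k$ changes $x_k$ from $1$ to $0$; changes $x_k$ from $0$ to $1$ if the result is still independent; and otherwise does nothing. Let $\tau=\tau_n\circ\cdots\circ\tau_1$ (a bijection on independent sets), and $x^{(i)}=\tau^i(x)$ for $i\in\mathbb{Z}$. The scroll of $x$ is the array $X_{i,j}$ ($i\in\mathbb{Z}$, $j\in\{1,\dots,n\}$) with $X_{i,j}$ the $j$-th entry of $x^{(i)}$; the ticker tape is the bi-infinite sequence $(X_k)_{k\in\mathbb{Z}}$ with $X_{in+j}=X_{i,j}$. Positions $k$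 with $X_k=1$ are live. The successor $s$ sends a live $k$ to the unique live element of $\{k+2,k+n+1\}$; the co-successor $c$ sends a live $k$ to the unique live element of $\{k+2n-2,k+2n-1\}$; both are bijections on live entries. Snakes are the orbits of $s$ and co-snakes the orbits of $c$; let $\alpha$ be the number of snakes and $\beta$ the number of co-snakes. A step $k\to s(k)$ has type $E$ if $s(k)=k+2$ and type $D$ if $s(k)=k+n+1$; a step $k\to c(k)$ has type $S$ if $c(k)=k+2n-1$ and type $L$ if $c(k)=k+2n-2$. The slither from a live $k$ is the word of step types of $k\to s(k)\to\dots\to s^{\beta}(k)$; the co-slither from $k$ is the word of step types of $k\to c(k)\to\dots\to c^{\alpha}(k)$. Up to cyclic shift these do not depend on $k$ and are called the slither and co-slither of the ticker tape. *)

theory Defs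
  imports Main
begin

section \<open>Independent sets of the cycle graph and the toggle dynamics\<close>

definition cycle_edges :: "nat \<Rightarrow> nat set set" where
  "cycle_edges n = {{i, i + 1} | i. 1 \<le> i \<and> i < n} \<union> {{n, 1}}"

text \<open>The binary vector of an independent set is its indicator: the entry \<open>x\<^sub>j\<close> is 1 iff \<open>j \<in> I\<close>.\<close>

definition indep_sets :: "nat \<Rightarrow> nat set set" where
  "indep_sets n = {I. I \<subseteq> {1..n} \<and> (\<forall>e\<in>cycle_edges n. \<not> e \<subseteq> I)}"

definition toggle :: "nat \<Rightarrow> nat \<Rightarrow> nat set \<Rightarrow> nat set" where
  "toggle n k I =
     (if k \<in> I then I - {k}
      else if insert k I \<in> indep_sets n then insert k I
      else I)"

text \<open>\<^const>\<open>fold\<close> applies the toggle at 1 first and the toggle at \<open>n\<close> last.\<close>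

definition toggle_all :: "nat \<Rightarrow> nat set \<Rightarrow> nat set" where
  "toggle_all n = fold (toggle n) [1..<n + 1]"

text \<open>Integer iterates of a map \<open>f\<close> that is a bijection of \<open>A\<close> onto itself; only meaningful on \<open>A\<close>.\<close>

definition int_iterate :: "'a set \<Rightarrow> ('a \<Rightarrow> 'a) \<Rightarrow> int \<Rightarrow> 'a \<Rightarrow> 'a" where
  "int_iterate A f i =
     (if i \<ge> 0 then f ^^ nat i else inv_into A f ^^ nat (- i))"

definition orbit_of :: "'a set \<Rightarrow> ('a \<Rightarrow> 'a) \<Rightarrow> 'a \<Rightarrow> 'a set" where
  "orbit_of A f a = {int_iterate A f i a | i. True}"

section \<open>Scroll and ticker tape\<close>

definition scroll :: "nat \<Rightarrow> nat set \<Rightarrow> int \<Rightarrow> nat \<Rightarrow> nat" where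
  "scroll n x i j = of_bool (j \<in> int_iterate (indep_sets n) (toggle_all n) i x)"

text \<open>Every integer is uniquely \<open>i * n + j\<close> with \<open>1 \<le> j \<le> n\<close>; hence the shift by one.\<close>

definition ticker_tape :: "nat \<Rightarrow> nat set \<Rightarrow> int \<Rightarrow> nat" where
  "ticker_tape n x k = scroll n x ((k - 1) div int n) (nat ((k - 1) mod int n) + 1)"

section \<open>Snakes, co-snakes and their words\<close>

text \<open>Below, \<open>X\<close> is a ticker tape of an independent set of the cycle on \<open>n\<close> vertices.\<close>

definition live :: "(int \<Rightarrow> nat) \<Rightarrow> int set" where
  "live X = {k. X k = 1}"

definition successor :: "nat \<Rightarrow> (int \<Rightarrow> nat) \<Rightarrow> int \<Rightarrow> int" where
  "successor n X k = (THE m. m \<in> {k + 2, k + int n + 1} \<and> m \<in> live X)"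

definition cosuccessor :: "nat \<Rightarrow> (int \<Rightarrow> nat) \<Rightarrow> int \<Rightarrow> int" where
  "cosuccessor n X k = (THE m. m \<in> {k + 2 * int n - 2, k + 2 * int n - 1} \<and> m \<in> live X)"

definition snakes :: "nat \<Rightarrow> (int \<Rightarrow> nat) \<Rightarrow> int set set" where
  "snakes n X = orbit_of (live X) (successor n X) ` live X"

definition cosnakes :: "nat \<Rightarrow> (int \<Rightarrow> nat) \<Rightarrow> int set set" where
  "cosnakes n X = orbit_of (live X) (cosuccessor n X) ` live X"

datatype step = StepE | StepD

datatype costep = StepS | StepL

text \<open>For \<open>n \<ge> 2\<close> the two candidates are distinct, so testing for one of them decides the type.\<close>

definition step_type :: "nat \<Rightarrow> (int \<Rightarrow> nat) \<Rightarrow> int \<Rightarrow> step" where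
  "step_type n X k = (if successor n X k = k + 2 then StepE else StepD)"

definition costep_type :: "nat \<Rightarrow> (int \<Rightarrow> nat) \<Rightarrow> int \<Rightarrow> costep" where
  "costep_type n X k = (if cosuccessor n X k = k + 2 * int n - 1 then StepS else StepL)"

text \<open>The length of a slither is the number of co-snakes, and vice versa.\<close>

definition slither_from :: "nat \<Rightarrow> (int \<Rightarrow> nat) \<Rightarrow> int \<Rightarrow> step list" where
  "slither_from n X k =
     map (\<lambda>i. step_type n X ((successor n X ^^ i) k)) [0..<card (cosnakes n X)]"

definition coslither_from :: "nat \<Rightarrow> (int \<Rightarrow> nat) \<Rightarrow> int \<Rightarrow> costep list" where
  "coslither_from n X k =
     map (\<lambda>i. costep_type n X ((cosuccessor n X ^^ i) k)) [0..<card (snakes n X)]"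

definition cyclic_shift :: "'a list \<Rightarrow> 'a list \<Rightarrow> bool" where
  "cyclic_shift v w \<longleftrightarrow> (\<exists>m. v = rotate m w)"

text \<open>
  The words read from different live positions agree up to cyclic shift, so requiring the
  condition at all of them loses nothing; nonemptiness excludes a vacuous reading.
\<close>

definition has_slither :: "nat \<Rightarrow> (int \<Rightarrow> nat) \<Rightarrow> step list \<Rightarrow> bool" where
  "has_slither n X w \<longleftrightarrow>
     live X \<noteq> {} \<and> (\<forall>k\<in>live X. cyclic_shift (slither_from n X k) w)"

definition has_coslither :: "nat \<Rightarrow> (int \<Rightarrow> nat) \<Rightarrow> costep list \<Rightarrow> bool" where
  "has_coslither n X w \<longleftrightarrow>
     live X \<noteq> {} \<and> (\<forall>k\<in>live X. cyclic_shift (coslither_from n X k) w)"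

end

theory Submission
  imports Defs
begin

text \<open>
  The tape is an array on \<open>\<int>\<^sup>2\<close> modulo \<open>(1, -n)\<close>, and in the plane the steps are the vectors
  \<open>E = (0, 2)\<close>, \<open>D = (1, 1)\<close>, \<open>S = (2, -1)\<close>, \<open>L = (2, -2)\<close>. Extend the two words periodically to
  all of \<open>\<int>\<close>, and let \<open>(a, b)\<close> be sent to the sum of the first \<open>a\<close> letters of the slither and the
  first \<open>b\<close> letters of the co-slither. Feasibility says precisely that the two periods differ by
  the vector \<open>(-1, n)\<close>, so the image \<open>P\<close> descends to a subset of \<open>\<int>\<close>. It is a ticker tape: the
  toggle rule asks that \<open>k\<close> be in \<open>P\<close> iff none of \<open>k - 1\<close>, \<open>k - n\<close>, \<open>k - n + 1\<close> is. The three
  differences do not occur in \<open>P\<close> because the slither vectors and the co-slither vectors span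
  separated cones, and if \<open>k\<close> lies in \<open>P + {0, 1, n - 1, n}\<close> then so do its neighbours, which is
  seen by taking one step along a snake or a co-snake.
\<close>

section \<open>Signed partial sums\<close>

text \<open>One of the two sums is always empty. The sign makes this the discrete antiderivative of
  \<open>d\<close> vanishing at 0, so that its recursion holds for negative indices too.\<close>

definition isum :: "(int \<Rightarrow> int) \<Rightarrow> int \<Rightarrow> int" where
  "isum d a = sum d {0..<a} - sum d {a..<0}"

lemma isum_0 [simp]: "isum d 0 = 0"
  by (simp add: isum_def)

lemma isum_add1: "isum d (a + 1) = isum d a + d a"
proof (cases "a \<ge> 0")
  case True
  then have "{0..<a + 1} = insert a {0..<a}" by auto
  with True show ?thesis by (simp add: isum_def)
next
  case False
  then have "{a..<0} = insert a {a + 1..<0}" by auto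
  with False show ?thesis by (simp add: isum_def)
qed

lemmas isum_1_add = isum_add1[unfolded add.commute[of _ 1]]

lemma isum_diff1: "isum d (a - 1) = isum d a - d (a - 1)"
  using isum_add1[of d "a - 1"] by simp

lemma isum_periodic:
  assumes "\<And>a. d (a + p) = d a"
  shows "isum d (a + t * p) = isum d a + t * isum d p"
proof -
  have period: "isum d (a + p) = isum d a + isum d p" for a
  proof (induction a rule: int_induct[where k = 0])
    case (step1 a)
    then show ?case
      using isum_add1[of d "a + p"] assms[of a] by (simp add: isum_1_add algebra_simps)
  next
    case (step2 a)
    then show ?case
      using isum_diff1[of d "a + p"] assms[of "a - 1"] by (simp add: isum_diff1 algebra_simps)
  qed simp
  show ?thesis
  proof (induction t rule: int_induct[where k = 0])
    case (step1 t)
    then show ?case using period[of "a + t * p"] by (simp add: algebra_simps)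
  next
    case (step2 t)
    then show ?case using period[of "a + (t - 1) * p"] by (simp add: algebra_simps)
  qed simp
qed

lemma isum_bounds:
  assumes "\<And>a. d a \<in> {0, 1}" and "a \<le> a'"
  shows "isum d a \<le> isum d a'" and "isum d a' \<le> isum d a + (a' - a)"
proof -
  have "isum d a \<le> isum d a' \<and> isum d a' \<le> isum d a + (a' - a)"
    using assms(2)
  proof (induction a' rule: int_ge_induct)
    case (step i)
    then show ?case using assms(1)[of i] by (auto simp: isum_add1)
  qed simp
  then show "isum d a \<le> isum d a'" "isum d a' \<le> isum d a + (a' - a)" by auto
qed

lemma isum_eq_sum_nat: "isum d (int m) = (\<Sum>i<m. d (int i))"
  by (induction m) (simp_all add: isum_add1 add.commute[of 1])

lemma count_list_eq_sum: "int (count_list w x) = (\<Sum>i<length w. of_bool (w ! i = x))"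
proof (induction w rule: rev_induct)
  case (snoc y w)
  have "(\<Sum>i<length w. of_bool ((w @ [y]) ! i = x)) = (\<Sum>i<length w. of_bool (w ! i = x) :: int)"
    by (intro sum.cong) (simp_all add: nth_append)
  with snoc show ?case by simp
qed simp

section \<open>Iterates and toggles\<close>

text \<open>If \<open>g\<close> runs through an orbit bi-infinitely, then injectivity makes
  \<open>inv_into\<close> step back along \<open>g\<close>. Negative iterates are thus known without
  describing the inverse map.\<close>

lemma int_iterate_eqI:
  assumes inj: "inj_on f A" and g: "\<And>i. g i \<in> A" "\<And>i. f (g i) = g (i + 1)"
  shows "int_iterate A f i (g j) = g (j + i)"
proof -
  have fwd: "(f ^^ m) (g j) = g (j + int m)" for m
    by (induction m) (simp_all add: g(2) algebra_simps)
  have "inv_into A f (g i) = g (i - 1)" for i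
    using inj g(1) by (rule inv_into_f_eq) (simp add: g(2))
  then have bwd: "(inv_into A f ^^ m) (g j) = g (j - int m)" for m
    by (induction m) (simp_all add: algebra_simps)
  show ?thesis by (simp add: int_iterate_def fwd bwd)
qed

lemma orbit_of_eqI:
  fixes g :: "int \<Rightarrow> 'a"
  assumes "inj_on f A" and "\<And>i. g i \<in> A" "\<And>i. f (g i) = g (i + 1)"
  shows "orbit_of A f (g j) = range g"
proof -
  have "orbit_of A f (g j) = {g (j + i) | i. True}"
    using int_iterate_eqI[of f A g, OF assms] by (simp add: orbit_of_def)
  also have "\<dots> = range g"
  proof (intro equalityI subsetI)
    fix y assume "y \<in> range g"
    then obtain i where "y = g i" by blast
    then have "y = g (j + (i - j))" by simp
    then show "y \<in> {g (j + i) | i. True}" by blast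
  qed auto
  finally show ?thesis .
qed

lemma indep_sets_subset: "I \<in> indep_sets n \<Longrightarrow> J \<subseteq> I \<Longrightarrow> J \<in> indep_sets n"
  unfolding indep_sets_def by blast

lemma toggle_in_indep_sets: "I \<in> indep_sets n \<Longrightarrow> toggle n k I \<in> indep_sets n"
  using indep_sets_subset[of I n "I - {k}"] by (auto simp: toggle_def)

lemma toggle_toggle: "I \<in> indep_sets n \<Longrightarrow> toggle n k (toggle n k I) = I"
  by (auto simp: toggle_def insert_absorb)

text \<open>Each toggle is an involution on the independent sets, and injectivity survives
  composition.\<close>

lemma inj_on_toggle_all: "inj_on (toggle_all n) (indep_sets n)"
proof -
  have "inj_on (fold (toggle n) ks) (indep_sets n)" for ks
  proof (induction ks)
    case (Cons k ks)
    have "inj_on (toggle n k) (indep_sets n)"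
      by (rule inj_on_inverseI[where g = "toggle n k"]) (rule toggle_toggle)
    moreover have "inj_on (fold (toggle n) ks) (toggle n k ` indep_sets n)"
      by (rule inj_on_subset[OF Cons]) (auto intro: toggle_in_indep_sets)
    ultimately show ?case by (simp add: comp_inj_on[unfolded comp_def])
  qed simp
  then show ?thesis by (simp add: toggle_all_def)
qed

section \<open>Ticker tapes from the toggle rule\<close>

text \<open>When position k is decided, k - n is the old entry at the same vertex, while k - 1 and k
  - n + 1 are the current entries at its two neighbours. The linear order of the tape absorbs the
  wrap from n to 1.\<close>

locale toggle_rule =
  fixes n :: nat and L :: "int set"
  assumes n_ge_2: "n \<ge> 2"
    and rule: "k \<in> L \<longleftrightarrow> k - 1 \<notin> L \<and> k - int n \<notin> L \<and> k - int n + 1 \<notin> L"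
begin

definition vertex :: "int \<Rightarrow> nat" where
  "vertex q = nat ((q - 1) mod int n) + 1"

text \<open>The intermediate states of the toggle dynamics are the windows of \<open>n\<close> consecutive entries.\<close>

definition window :: "int \<Rightarrow> nat set" where
  "window m = vertex ` {q \<in> L. m - int n < q \<and> q \<le> m}"

lemma vertex_in: "vertex q \<in> {1..n}"
  using n_ge_2 by (simp add: vertex_def Suc_le_eq nat_less_iff)

lemma vertex_eq_iff: "vertex q = vertex q' \<longleftrightarrow> int n dvd q - q'"
proof -
  have "vertex q = vertex q' \<longleftrightarrow> (q - 1) mod int n = (q' - 1) mod int n"
    using n_ge_2 by (simp add: vertex_def eq_nat_nat_iff)
  then show ?thesis by (simp add: mod_eq_dvd_iff)
qed

lemma vertex_of_nat: "1 \<le> i \<Longrightarrow> i \<le> n \<Longrightarrow> vertex (int i) = i"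
  by (simp add: vertex_def nat_diff_distrib)

lemma vertex_eq_in_window:
  assumes "vertex q = vertex q'" and "m - int n < q" "q \<le> m" "m - int n < q'" "q' \<le> m"
  shows "q = q'"
proof (rule ccontr)
  assume "q \<noteq> q'"
  moreover have "int n dvd q - q'" using assms(1) by (simp add: vertex_eq_iff)
  ultimately have "int n \<le> \<bar>q - q'\<bar>" using dvd_imp_le_int[of "q - q'" "int n"] by simp
  with assms show False by linarith
qed

text \<open>Indexing the edges by tape positions removes the special role of the edge joining n and
  1.\<close>

lemma cycle_edges_eq: "cycle_edges n = {{vertex q, vertex (q + 1)} | q. True}"
proof (intro set_eqI iffI)
  fix e assume "e \<in> cycle_edges n"
  then consider i where "1 \<le> i" "i < n" "e = {i, i + 1}" | "e = {n, 1}"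
    by (auto simp: cycle_edges_def)
  then show "e \<in> {{vertex q, vertex (q + 1)} | q. True}"
  proof cases
    case 1
    then have "e = {vertex (int i), vertex (int i + 1)}"
      using vertex_of_nat[of i] vertex_of_nat[of "i + 1"] by (simp add: add.commute)
    then show ?thesis by blast
  next
    case 2
    have "vertex (int n + 1) = 1" by (simp add: vertex_def)
    with 2 have "e = {vertex (int n), vertex (int n + 1)}"
      using vertex_of_nat[of n] n_ge_2 by simp
    then show ?thesis by blast
  qed
next
  fix e assume "e \<in> {{vertex q, vertex (q + 1)} | q. True}"
  then obtain q where e: "e = {vertex q, vertex (q + 1)}" by blast
  define i where "i = vertex q"
  have i: "1 \<le> i" "i \<le> n" using vertex_in[of q] by (auto simp: i_def)
  then have "vertex (int i) = vertex q" by (simp add: vertex_of_nat i_def)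
  then have "vertex (q + 1) = vertex (int i + 1)" by (simp add: vertex_eq_iff dvd_diff_commute)
  also have "\<dots> = (if i < n then i + 1 else 1)"
    using vertex_of_nat[of "i + 1"] i by (auto simp: vertex_def add.commute)
  finally show "e \<in> cycle_edges n"
    using e i by (auto simp: cycle_edges_def i_def[symmetric])
qed

lemma not_adjacent: "k \<in> L \<Longrightarrow> k + 1 \<notin> L"
  using rule[of "k + 1"] by simp

lemma not_n_apart: "k \<in> L \<Longrightarrow> k + int n \<notin> L"
  using rule[of "k + int n"] by simp

lemma not_n1_apart: "k \<in> L \<Longrightarrow> k + int n - 1 \<notin> L"
  using rule[of "k + int n - 1"] by simp

text \<open>An edge inside the window gives live q1, q2 with q2 congruent to q1 + 1 modulo n. Within
  n consecutive positions they differ by 1 or by n - 1, and the rule forbids both.\<close>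

lemma window_in_indep_sets: "window m \<in> indep_sets n"
proof -
  have False if edge: "{vertex q, vertex (q + 1)} \<subseteq> window m" for q
  proof -
    from edge obtain q1 q2 where q1: "q1 \<in> L" "m - int n < q1" "q1 \<le> m" "vertex q1 = vertex q"
      and q2: "q2 \<in> L" "m - int n < q2" "q2 \<le> m" "vertex q2 = vertex (q + 1)"
      unfolding window_def by auto
    have "int n dvd (q2 - (q + 1)) - (q1 - q)"
      using q1(4) q2(4) unfolding vertex_eq_iff by (rule dvd_diff[rotated])
    moreover have "(q2 - (q + 1)) - (q1 - q) = q2 - (q1 + 1)"
      by simp
    ultimately have v: "vertex q2 = vertex (q1 + 1)"
      by (simp only: vertex_eq_iff)
    show False
    proof (cases "q1 = m")
      \<comment> \<open>After the last position of the window, the next vertex is the one at the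
        first position, m + 1 - n.\<close>
      case True
      have "vertex (q1 + 1) = vertex (q1 + 1 - int n)" by (simp add: vertex_eq_iff)
      with v have "q2 = q1 + 1 - int n"
        using vertex_eq_in_window[of q2 "q1 + 1 - int n" m] q2 True n_ge_2 by simp
      then show False using not_n1_apart[of q2] q1 q2 by simp
    next
      case False
      with v have "q2 = q1 + 1"
        using vertex_eq_in_window[of q2 "q1 + 1" m] q1 q2 by simp
      then show False using not_adjacent[of q1] q1 q2 by simp
    qed
  qed
  moreover have "window m \<subseteq> {1..n}"
    using vertex_in unfolding window_def by blast
  ultimately show ?thesis
    unfolding indep_sets_def cycle_edges_eq by blast
qed

lemma vertex_in_window_iff:
  assumes "m - int n < q" "q \<le> m"
  shows "vertex q \<in> window m \<longleftrightarrow> q \<in> L"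
  using vertex_eq_in_window[of q _ m] assms by (auto simp: window_def)

lemma toggle_window: "toggle n (vertex (m + 1)) (window m) = window (m + 1)"
proof -
  define v where "v = vertex (m + 1)"
  have v: "v = vertex (m + 1 - int n)" by (simp add: v_def vertex_eq_iff)
  have v_iff: "v \<in> window m \<longleftrightarrow> m + 1 - int n \<in> L"
    unfolding v using n_ge_2 by (intro vertex_in_window_iff) auto
  \<comment> \<open>The part common to both windows. They can differ only at \<open>v\<close>, the
    vertex leaving at m + 1 - n and entering at m + 1.\<close>
  define M where "M = vertex ` {q \<in> L. m + 1 - int n < q \<and> q \<le> m}"
  have "{q \<in> L. m - int n < q \<and> q \<le> m} =
      {q \<in> L. m + 1 - int n < q \<and> q \<le> m} \<union> ({m + 1 - int n} \<inter> L)"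
    using n_ge_2 by auto
  then have win: "window m = M \<union> (if m + 1 - int n \<in> L then {v} else {})"
    by (auto simp: window_def M_def v)
  have "{q \<in> L. m + 1 - int n < q \<and> q \<le> m + 1} =
      {q \<in> L. m + 1 - int n < q \<and> q \<le> m} \<union> ({m + 1} \<inter> L)"
    using n_ge_2 by auto
  then have win': "window (m + 1) = M \<union> (if m + 1 \<in> L then {v} else {})"
    by (auto simp: window_def M_def v_def)
  have "v \<notin> M"
    using vertex_eq_in_window[of _ "m + 1" "m + 1"] n_ge_2 by (fastforce simp: M_def v_def)
  \<comment> \<open>The three clauses of \<open>toggle\<close>: the vertex is removed, inserted, or
    blocked.\<close>
  consider "m + 1 - int n \<in> L" | "m + 1 \<in> L" "m + 1 - int n \<notin> L"
    | "m + 1 \<notin> L" "m + 1 - int n \<notin> L" by blast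
  then show ?thesis
  proof cases
    case 1
    then have "m + 1 \<notin> L" using not_n_apart by force
    with 1 show ?thesis
      using \<open>v \<notin> M\<close> v_iff win win' by (auto simp: toggle_def v_def[symmetric])
  next
    case 2
    then have "insert v (window m) = window (m + 1)" using win win' by simp
    then show ?thesis
      using 2 v_iff window_in_indep_sets[of "m + 1"] by (simp add: toggle_def v_def[symmetric])
  next
    case 3
    \<comment> \<open>With k = m + 1 and k - n both dead, the rule leaves a live neighbour of
      \<open>v\<close> inside the window.\<close>
    then consider "m \<in> L" | "m + 2 - int n \<in> L"
      using rule[of "m + 1"] by (auto simp: algebra_simps)
    then have "insert v (window m) \<notin> indep_sets n"
    proof cases
      case 1
      then have "vertex m \<in> window m" using n_ge_2 by (simp add: vertex_in_window_iff)
      then have "{vertex m, vertex (m + 1)} \<subseteq> insert v (window m)" by (simp add: v_def)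
      then show ?thesis unfolding indep_sets_def cycle_edges_eq by blast
    next
      case 2
      then have "vertex (m + 1 - int n + 1) \<in> window m"
        using n_ge_2 by (subst vertex_in_window_iff) (auto simp: algebra_simps)
      then have "{vertex (m + 1 - int n), vertex (m + 1 - int n + 1)} \<subseteq> insert v (window m)"
        by (simp add: v)
      then show ?thesis unfolding indep_sets_def cycle_edges_eq by blast
    qed
    with 3 show ?thesis using v_iff win win' by (simp add: toggle_def v_def[symmetric])
  qed
qed

lemma toggle_all_window: "toggle_all n (window (i * int n)) = window ((i + 1) * int n)"
proof -
  have "fold (toggle n) [1..<k + 1] (window (i * int n)) = window (i * int n + int k)"
    if "k \<le> n" for k
    using that
  proof (induction k)
    case (Suc k)
    have "vertex (i * int n + int k + 1) = Suc k"
      using Suc.prems n_ge_2 by (simp add: vertex_def nat_mod_as_int)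
    then have "toggle n (Suc k) (window (i * int n + int k)) = window (i * int n + int k + 1)"
      using toggle_window[of "i * int n + int k"] by simp
    with Suc show ?case by (simp add: algebra_simps)
  qed simp
  from this[of n] show ?thesis by (simp add: toggle_all_def algebra_simps)
qed

text \<open>Row i of the scroll occupies the positions i n + 1 to (i + 1) n. Hence row 0, the
  initial set, is the window ending at n.\<close>

lemma int_iterate_window:
  "int_iterate (indep_sets n) (toggle_all n) i (window (int n)) = window ((i + 1) * int n)"
  using int_iterate_eqI[where g = "\<lambda>i. window (i * int n)" and j = 1 and i = i,
      OF inj_on_toggle_all window_in_indep_sets toggle_all_window]
  by (simp add: add.commute)

lemma ticker_tape_window: "ticker_tape n (window (int n)) = (\<lambda>k. of_bool (k \<in> L))"
proof
  fix k :: int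
  define i where "i = (k - 1) div int n"
  have "k - 1 = i * int n + (k - 1) mod int n" by (simp add: i_def)
  moreover have "0 \<le> (k - 1) mod int n" "(k - 1) mod int n < int n" using n_ge_2 by auto
  ultimately have "(i + 1) * int n - int n < k" "k \<le> (i + 1) * int n"
    by (simp_all add: algebra_simps)
  then have "vertex k \<in> window ((i + 1) * int n) \<longleftrightarrow> k \<in> L" by (rule vertex_in_window_iff)
  then show "ticker_tape n (window (int n)) k = of_bool (k \<in> L)"
    by (simp add: ticker_tape_def scroll_def int_iterate_window i_def vertex_def)
qed

end

section \<open>The lattice of live positions\<close>

text \<open>Here \<open>d\<close> indicates the letters \<open>D\<close> of the slither and \<open>e\<close> the letters \<open>S\<close> of the co-slither.\<close>

locale feasible_pair =
  fixes n \<alpha> \<beta> :: nat and d e :: "int \<Rightarrow> int"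
  assumes n_ge_2: "n \<ge> 2" and pos: "\<alpha> > 0" "\<beta> > 0"
    and d01: "\<And>a. d a \<in> {0, 1}" and e01: "\<And>b. e b \<in> {0, 1}"
    and d_periodic: "\<And>a. d (a + int \<beta>) = d a" and e_periodic: "\<And>b. e (b + int \<alpha>) = e b"
    and d_sum: "isum d (int \<beta>) = 2 * int \<alpha> - 1"
    and feasible: "2 * int \<beta> - isum d (int \<beta>) + 2 * int \<alpha> - isum e (int \<alpha>) = int n"
begin

definition row :: "int \<Rightarrow> int \<Rightarrow> int" where
  "row a b = isum d a + 2 * b"

text \<open>The step vectors in one formula: E adds 2 and D adds 1, while S adds -1 and L adds
  -2.\<close>

definition col :: "int \<Rightarrow> int \<Rightarrow> int" where
  "col a b = 2 * a - isum d a - 2 * b + isum e b"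

definition position :: "int \<Rightarrow> int \<Rightarrow> int" where
  "position a b = int n * row a b + col a b"

definition positions :: "int set" where
  "positions = {position a b | a b. True}"

lemma positions_eq: "positions = (\<Union>b. range (\<lambda>a. position a b))"
  by (auto simp: positions_def)

lemma position_in [simp]: "position a b \<in> positions"
  by (auto simp: positions_def)

text \<open>A full slither climbs 2 \<alpha> - 1 rows and a full co-slither 2 \<alpha>, so their
  difference is -1 row. The companion \<open>col_shift\<close> uses \<open>feasible\<close> to get n
  columns, and \<open>position\<close> cancels the two.\<close>

lemma row_shift: "row (a + t * int \<beta>) (b - t * int \<alpha>) = row a b - t"
  by (simp add: row_def isum_periodic[where d = d, OF d_periodic] d_sum algebra_simps)

lemma col_shift: "col (a + t * int \<beta>) (b - t * int \<alpha>) = col a b + t * int n"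
proof -
  have "isum e (b - t * int \<alpha>) = isum e b - t * isum e (int \<alpha>)"
    using isum_periodic[where d = e and a = b and t = "- t", OF e_periodic] by simp
  then show ?thesis
    by (simp add: col_def isum_periodic[where d = d, OF d_periodic] feasible[symmetric] algebra_simps)
qed

lemma position_shift: "position (a + t * int \<beta>) (b - t * int \<alpha>) = position a b"
  by (simp add: position_def row_shift col_shift algebra_simps)

text \<open>Any difference of two positions can be read off in the plane with prescribed row.\<close>

lemma position_diff_lift:
  obtains t where "row (a' + t * int \<beta>) (b' - t * int \<alpha>) - row a b = r"
    and "col (a' + t * int \<beta>) (b' - t * int \<alpha>) - col a b
      = position a' b' - position a b - int n * r"
proof -
  let ?t = "row a' b' - row a b - r"
  show ?thesis
    by (rule that[of ?t]; unfold row_shift col_shift) (simp_all add: position_def algebra_simps)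
qed

section \<open>Differences that cannot occur between positions\<close>

lemma isum_diff_bounds:
  assumes "\<And>a. f a \<in> {0, 1}"
  shows "0 \<le> isum f a' - isum f a \<and> isum f a' - isum f a \<le> a' - a \<or>
    a' - a \<le> isum f a' - isum f a \<and> isum f a' - isum f a \<le> 0"
  using isum_bounds[of f a a', OF assms] isum_bounds[of f a' a, OF assms] by linarith

text \<open>The excluded vectors are plane representatives of the distances 1, n - 1 and n. The
  second claim is injectivity of the planar map.\<close>

lemma planar_diff:
  assumes r: "row a' b' - row a b = r" and c: "col a' b' - col a b = c"
  shows "(r, c) \<notin> {(0, 1), (1, -1), (1, 0)}" and "(r, c) = (0, 0) \<Longrightarrow> a' = a \<and> b' = b"
proof -
  define i j p q where "i = a' - a" and "j = b' - b"
    and "p = isum d a' - isum d a" and "q = isum e b' - isum e b"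
  note defs = i_def j_def p_def q_def
  have p: "0 \<le> p \<and> p \<le> i \<or> i \<le> p \<and> p \<le> 0" and q: "0 \<le> q \<and> q \<le> j \<or> j \<le> q \<and> q \<le> 0"
    using isum_diff_bounds[of d a' a, OF d01] isum_diff_bounds[of e b' b, OF e01]
    by (simp_all add: defs)
  have r: "r = p + 2 * j" and c: "c = 2 * i - p - 2 * j + q"
    using r c by (simp_all add: defs row_def col_def algebra_simps)
  \<comment> \<open>Here r + c = 2 i + q. If j is positive, r <= 1 forces i <= 1 - 2 j and so r + c
    <= 2 - 3 j < 0; if j is negative, r >= 0 forces i >= -2 j and so r + c >= -3 j > 1.\<close>
  have "j = 0" if "0 \<le> r" "r \<le> 1" "0 \<le> r + c" "r + c \<le> 1"
  proof (rule ccontr)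
    assume "j \<noteq> 0"
    then consider "j \<ge> 1" | "j \<le> -1" by linarith
    then show False using p q r c that by cases linarith+
  qed
  moreover have "q = 0" if "j = 0" using q that by linarith
  \<comment> \<open>With j = q = 0 the sum r + c = 2 i is even, which excludes (0, 1) and (1, 0).
    For (1, -1) it gives i = 0, hence p = 0, against r = 1.\<close>
  moreover have "2 * i \<noteq> 1" by presburger
  ultimately show "(r, c) \<notin> {(0, 1), (1, -1), (1, 0)}"
    using p r c by auto
  show "a' = a \<and> b' = b" if "(r, c) = (0, 0)"
    using \<open>\<lbrakk>0 \<le> r; r \<le> 1; 0 \<le> r + c; r + c \<le> 1\<rbrakk> \<Longrightarrow> j = 0\<close>
      \<open>j = 0 \<Longrightarrow> q = 0\<close> r c that by (auto simp: defs)
qed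

text \<open>Planar injectivity leaves only the period (\<beta>, -\<alpha>) as a source of
  coincidences. Injectivity of the two successors and the counts of orbits rest on this.\<close>

lemma position_eq_iff:
  "position a b = position a' b' \<longleftrightarrow>
    (\<exists>t. a = a' + t * int \<beta> \<and> b = b' - t * int \<alpha>)"
proof
  assume eq: "position a b = position a' b'"
  obtain t where "row (a' + t * int \<beta>) (b' - t * int \<alpha>) - row a b = 0"
    "col (a' + t * int \<beta>) (b' - t * int \<alpha>) - col a b = 0"
    using position_diff_lift[of a' b' a b 0] eq by auto
  then show "\<exists>t. a = a' + t * int \<beta> \<and> b = b' - t * int \<alpha>"
    using planar_diff(2) by metis
qed (auto simp: position_shift)

lemma not_apart:
  assumes "k \<in> positions"
  shows "k + 1 \<notin> positions" "k + int n \<notin> positions" "k + int n - 1 \<notin> positions"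
proof -
  obtain a b where k: "k = position a b" using assms by (auto simp: positions_def)
  have no: "position a b + int n * r + c \<noteq> position a' b'"
    if "(r, c) \<in> {(0, 1), (1, -1), (1, 0)}" for a' b' r c
  proof
    assume "position a b + int n * r + c = position a' b'"
    then have "position a' b' - position a b - int n * r = c" by simp
    then obtain t where "row (a' + t * int \<beta>) (b' - t * int \<alpha>) - row a b = r"
      "col (a' + t * int \<beta>) (b' - t * int \<alpha>) - col a b = c"
      using position_diff_lift[of a' b' a b r] by metis
    then show False using planar_diff(1) that by metis
  qed
  show "k + 1 \<notin> positions" "k + int n \<notin> positions" "k + int n - 1 \<notin> positions"
    using no[of 0 1] no[of 1 0] no[of 1 "-1"] by (auto simp: k positions_def)
qed

section \<open>Steps along snakes and co-snakes, and the covering of all integers\<close>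

lemma position_add1_left:
  "position (a + 1) b = (if d a = 0 then position a b + 2 else position a b + int n + 1)"
  using d01[of a] by (auto simp: position_def row_def col_def isum_1_add algebra_simps)

lemma position_add1_right:
  "position a (b + 1) =
    (if e b = 1 then position a b + 2 * int n - 1 else position a b + 2 * int n - 2)"
  using e01[of b] by (auto simp: position_def row_def col_def isum_1_add algebra_simps)

lemma next_on_snake:
  assumes "k \<in> positions"
  obtains k' where "k' \<in> positions" "k' = k + 2 \<or> k' = k + int n + 1"
proof -
  obtain a b where "k = position a b" using assms by (auto simp: positions_def)
  then show ?thesis
    using that[OF position_in[of "a + 1" b]] position_add1_left[of a b] by (auto split: if_splits)
qed

lemma previous_on_snake:
  assumes "k \<in> positions"
  obtains k' where "k' \<in> positions" "k = k' + 2 \<or> k = k' + int n + 1"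
proof -
  obtain a b where "k = position a b" using assms by (auto simp: positions_def)
  then show ?thesis
    using that[OF position_in[of "a - 1" b]] position_add1_left[of "a - 1" b] by (auto split: if_splits)
qed

lemma next_on_cosnake:
  assumes "k \<in> positions"
  obtains k' where "k' \<in> positions" "k' = k + 2 * int n - 1 \<or> k' = k + 2 * int n - 2"
proof -
  obtain a b where "k = position a b" using assms by (auto simp: positions_def)
  then show ?thesis
    using that[OF position_in[of a "b + 1"]] position_add1_right[of a b] by (auto split: if_splits)
qed

lemma previous_on_cosnake:
  assumes "k \<in> positions"
  obtains k' where "k' \<in> positions" "k = k' + 2 * int n - 1 \<or> k = k' + 2 * int n - 2"
proof -
  obtain a b where "k = position a b" using assms by (auto simp: positions_def)
  then show ?thesis
    using that[OF position_in[of a "b - 1"]] position_add1_right[of a "b - 1"] by (auto split: if_splits)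
qed

text \<open>The half of the toggle rule not given by \<open>not_apart\<close>: every position is
  live or blocked by one of the three earlier entries.\<close>

definition covered :: "int \<Rightarrow> bool" where
  "covered k \<longleftrightarrow>
    k \<in> positions \<or> k - 1 \<in> positions \<or> k - int n \<in> positions \<or> k - int n + 1 \<in> positions"

lemma coveredI:
  assumes "q \<in> positions" and "k = q \<or> k = q + 1 \<or> k = q + int n \<or> k = q + int n - 1"
  shows "covered k"
  using assms by (auto simp: covered_def)

lemma coveredE:
  assumes "covered k"
  obtains q where "q \<in> positions" "k = q \<or> k = q + 1 \<or> k = q + int n \<or> k = q + int n - 1"
  using assms by (fastforce simp: covered_def)

text \<open>From q and q + n - 1 the move stays among the translates of q. From q + 1 and q + n it
  needs the next position on the snake.\<close>

lemma covered_add1: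
  assumes "covered k"
  shows "covered (k + 1)"
proof -
  obtain q where q: "q \<in> positions" "k = q \<or> k = q + 1 \<or> k = q + int n \<or> k = q + int n - 1"
    using assms by (rule coveredE)
  obtain q' where q': "q' \<in> positions" "q' = q + 2 \<or> q' = q + int n + 1"
    using next_on_snake[OF q(1)] by blast
  obtain q'' where q'': "q'' \<in> positions" "q' = q'' + 2 * int n - 1 \<or> q' = q'' + 2 * int n - 2"
    using previous_on_cosnake[OF q'(1)] by blast
  from q(2) show ?thesis
  proof (elim disjE)
    assume "k = q + 1"
    show ?thesis
    proof (cases "q' = q + 2")
      case True
      with \<open>k = q + 1\<close> show ?thesis by (intro coveredI[OF q'(1)]) simp
    next
      \<comment> \<open>Here q' = q + n + 1, and stepping back on the co-snake gives q'' = q - n + 2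
        or q - n + 3, so q + 2 is q'' + n or q'' + n - 1.\<close>
      case False
      with q'(2) q''(2) \<open>k = q + 1\<close> show ?thesis by (intro coveredI[OF q''(1)]) linarith
    qed
  next
    assume "k = q + int n"
    with q'(2) show ?thesis by (intro coveredI[OF q'(1)]) linarith
  qed (intro coveredI[OF q(1)]; simp)+
qed

lemma covered_diff1:
  assumes "covered k"
  shows "covered (k - 1)"
proof -
  obtain q where q: "q \<in> positions" "k = q \<or> k = q + 1 \<or> k = q + int n \<or> k = q + int n - 1"
    using assms by (rule coveredE)
  obtain q' where q': "q' \<in> positions" "q = q' + 2 \<or> q = q' + int n + 1"
    using previous_on_snake[OF q(1)] by blast
  obtain q'' where q'': "q'' \<in> positions" "q'' = q' + 2 * int n - 1 \<or> q'' = q' + 2 * int n - 2"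
    using next_on_cosnake[OF q'(1)] by blast
  from q(2) show ?thesis
  proof (elim disjE)
    assume "k = q"
    with q'(2) show ?thesis by (intro coveredI[OF q'(1)]) linarith
  next
    assume "k = q + int n - 1"
    show ?thesis
    proof (cases "q = q' + 2")
      case True
      with \<open>k = q + int n - 1\<close> show ?thesis by (intro coveredI[OF q'(1)]) simp
    next
      \<comment> \<open>Here q = q' + n + 1, so k - 1 = q' + 2 n - 1, which is q'' or q'' +
        1.\<close>
      case False
      with q'(2) q''(2) \<open>k = q + int n - 1\<close> show ?thesis by (intro coveredI[OF q''(1)]) linarith
    qed
  qed (intro coveredI[OF q(1)]; simp)+
qed

lemma covered: "covered k"
proof (induction k rule: int_induct[where k = "position 0 0"])
  case base
  show ?case by (simp add: covered_def)
qed (auto intro: covered_add1 covered_diff1)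

sublocale toggle_rule n positions
proof
  show "k \<in> positions \<longleftrightarrow>
      k - 1 \<notin> positions \<and> k - int n \<notin> positions \<and> k - int n + 1 \<notin> positions" for k
    using not_apart(1)[of "k - 1"] not_apart(2)[of "k - int n"] not_apart(3)[of "k - int n + 1"]
      covered[of k] by (auto simp: covered_def)
qed (rule n_ge_2)

section \<open>Snakes, co-snakes and their words\<close>

abbreviation X :: "int \<Rightarrow> nat" where
  "X \<equiv> \<lambda>k. of_bool (k \<in> positions)"

lemma live_X: "live X = positions"
  by (simp add: live_def)

text \<open>The two candidates are n - 1 apart, so they are never both live. For
  \<open>cosuccessor_position\<close> they are adjacent.\<close>

lemma successor_position: "successor n X (position a b) = position (a + 1) b"
  unfolding successor_def live_X
proof (rule the_equality)
  show "position (a + 1) b \<in> {position a b + 2, position a b + int n + 1} \<and>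
      position (a + 1) b \<in> positions"
    using position_in[of "a + 1" b] position_add1_left[of a b] by auto
next
  fix m assume "m \<in> {position a b + 2, position a b + int n + 1} \<and> m \<in> positions"
  then show "m = position (a + 1) b"
    using position_add1_left[of a b] position_in[of "a + 1" b] not_n1_apart[of "position a b + 2"]
    by (auto simp: algebra_simps split: if_splits)
qed

lemma cosuccessor_position: "cosuccessor n X (position a b) = position a (b + 1)"
  unfolding cosuccessor_def live_X
proof (rule the_equality)
  show "position a (b + 1) \<in> {position a b + 2 * int n - 2, position a b + 2 * int n - 1} \<and>
      position a (b + 1) \<in> positions"
    using position_in[of a "b + 1"] position_add1_right[of a b] by auto
next
  fix m assume "m \<in> {position a b + 2 * int n - 2, position a b + 2 * int n - 1} \<and> m \<in> positions"
  moreover define p where "p = position a b + 2 * int n - 2"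
  ultimately have "m \<in> {p, p + 1}" "m \<in> positions" by auto
  moreover have "position a (b + 1) \<in> {p, p + 1}" by (simp add: position_add1_right p_def)
  ultimately show "m = position a (b + 1)"
    using not_adjacent[of p] position_in[of a "b + 1"] by (auto simp del: position_in)
qed

lemma inj_on_successor: "inj_on (successor n X) positions"
proof (rule inj_onI)
  fix k k' assume live: "k \<in> positions" "k' \<in> positions" and eq: "successor n X k = successor n X k'"
  obtain a b a' b' where k: "k = position a b" and k': "k' = position a' b'"
    using live unfolding positions_def by blast
  have "position (a + 1) b = position (a' + 1) b'"
    using eq by (simp only: k k' successor_position)
  then show "k = k'" by (auto simp: k k' position_eq_iff)
qed

lemma inj_on_cosuccessor: "inj_on (cosuccessor n X) positions"
proof (rule inj_onI)
  fix k k' assume live: "k \<in> positions" "k' \<in> positions" and eq: "cosuccessor n X k = cosuccessor n X k'"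
  obtain a b a' b' where k: "k = position a b" and k': "k' = position a' b'"
    using live unfolding positions_def by blast
  have "position a (b + 1) = position a' (b' + 1)"
    using eq by (simp only: k k' cosuccessor_position)
  then show "k = k'" by (auto simp: k k' position_eq_iff)
qed

text \<open>Snakes are the index lines with b fixed; co-snakes are those with a fixed.\<close>

lemma snake_eq: "orbit_of positions (successor n X) (position a b) = range (\<lambda>a. position a b)"
  by (rule orbit_of_eqI[where g = "\<lambda>a. position a b", OF inj_on_successor])
    (simp_all add: successor_position)

lemma cosnake_eq: "orbit_of positions (cosuccessor n X) (position a b) = range (position a)"
  by (rule orbit_of_eqI[OF inj_on_cosuccessor]) (simp_all add: cosuccessor_position)

section \<open>Numbers of snakes and co-snakes\<close>

lemma range_position_left_eq_iff:
  "range (\<lambda>a. position a b) = range (\<lambda>a. position a b') \<longleftrightarrow> b mod int \<alpha> = b' mod int \<alpha>"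
proof
  assume "range (\<lambda>a. position a b) = range (\<lambda>a. position a b')"
  then obtain a where "position 0 b = position a b'" by (metis (mono_tags, lifting) rangeE rangeI)
  then obtain t where "b = b' - t * int \<alpha>" using position_eq_iff by blast
  then show "b mod int \<alpha> = b' mod int \<alpha>" by (simp add: mod_eq_dvd_iff)
next
  have "range (\<lambda>a. position a b) \<subseteq> range (\<lambda>a. position a b')"
    if mod: "b mod int \<alpha> = b' mod int \<alpha>" for b b'
  proof -
    obtain t where "b' = b - t * int \<alpha>"
      using mod_eqE[OF mod[symmetric]] by (metis mult.commute add_diff_cancel_right')
    then have "position a b = position (a + t * int \<beta>) b'" for a by (simp add: position_shift)
    then show ?thesis by blast
  qed
  then show "range (\<lambda>a. position a b) = range (\<lambda>a. position a b')"
    if "b mod int \<alpha> = b' mod int \<alpha>" using that by (metis subset_antisym)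
qed

lemma range_position_right_eq_iff:
  "range (position a) = range (position a') \<longleftrightarrow> a mod int \<beta> = a' mod int \<beta>"
proof
  assume "range (position a) = range (position a')"
  then obtain b where "position a 0 = position a' b" by (metis (mono_tags, lifting) rangeE rangeI)
  then obtain t where "a = a' + t * int \<beta>" using position_eq_iff by blast
  then show "a mod int \<beta> = a' mod int \<beta>" by simp
next
  have "range (position a) \<subseteq> range (position a')"
    if mod: "a mod int \<beta> = a' mod int \<beta>" for a a'
  proof -
    obtain t where "a' = a + t * int \<beta>"
      using mod_eqE[OF mod] by (metis mult.commute)
    then have "position a b = position a' (b - t * int \<alpha>)" for b by (simp add: position_shift)
    then show ?thesis by blast
  qed
  then show "range (position a) = range (position a')"
    if "a mod int \<beta> = a' mod int \<beta>" using that by (metis subset_antisym)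
qed

lemma card_range_mod:
  fixes g :: "int \<Rightarrow> 'a"
  assumes "p > 0" and "\<And>a a'. g a = g a' \<longleftrightarrow> a mod int p = a' mod int p"
  shows "card (range g) = p"
proof -
  have "range g = g ` {0..<int p}"
  proof
    show "range g \<subseteq> g ` {0..<int p}"
    proof
      fix y assume "y \<in> range g"
      then obtain a where "y = g a" by blast
      then have "y = g (a mod int p)" by (simp add: assms(2))
      moreover have "a mod int p \<in> {0..<int p}" using assms(1) by simp
      ultimately show "y \<in> g ` {0..<int p}" by blast
    qed
  qed auto
  moreover have "inj_on g {0..<int p}" by (rule inj_onI) (simp add: assms(2))
  ultimately show ?thesis by (simp add: card_image)
qed

lemma card_snakes: "card (snakes n X) = \<alpha>"
proof -
  have "snakes n X = range (\<lambda>b. range (\<lambda>a. position a b))"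
    \<comment> \<open>Only the set over which the image is taken is rewritten; the
      \<open>positions\<close> inside \<open>orbit_of\<close> and \<open>X\<close> must stay for
      \<open>snake_eq\<close> to apply.\<close>
    unfolding snakes_def live_X image_cong[OF positions_eq refl, of "orbit_of _ _"]
    by (auto simp: image_UN image_image snake_eq)
  then show ?thesis
    using card_range_mod[of \<alpha>, OF pos(1) range_position_left_eq_iff] by simp
qed

lemma card_cosnakes: "card (cosnakes n X) = \<beta>"
proof -
  have "cosnakes n X = range (\<lambda>a. range (position a))"
    unfolding cosnakes_def live_X image_cong[OF positions_eq refl, of "orbit_of _ _"]
    by (auto simp: image_UN image_image cosnake_eq)
  then show ?thesis
    using card_range_mod[of \<beta>, OF pos(2) range_position_right_eq_iff] by simp
qed

lemma step_type_position: "step_type n X (position a b) = (if d a = 0 then StepE else StepD)"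
  using n_ge_2 by (simp add: step_type_def successor_position position_add1_left)

lemma costep_type_position: "costep_type n X (position a b) = (if e b = 1 then StepS else StepL)"
  by (simp add: costep_type_def cosuccessor_position position_add1_right)

lemma slither_from_position:
  "slither_from n X (position a b) =
    map (\<lambda>i. if d (a + int i) = 0 then StepE else StepD) [0..<\<beta>]"
proof -
  have "(successor n X ^^ i) (position a b) = position (a + int i) b" for i
    by (induction i) (simp_all add: successor_position algebra_simps)
  then show ?thesis by (simp add: slither_from_def card_cosnakes step_type_position)
qed

lemma coslither_from_position:
  "coslither_from n X (position a b) =
    map (\<lambda>i. if e (b + int i) = 1 then StepS else StepL) [0..<\<alpha>]"
proof -
  have "(cosuccessor n X ^^ i) (position a b) = position a (b + int i)" for i
    by (induction i) (simp_all add: cosuccessor_position algebra_simps)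
  then show ?thesis by (simp add: coslither_from_def card_snakes costep_type_position)
qed

end

section \<open>Periodic extension of a word\<close>

definition letter :: "'a list \<Rightarrow> int \<Rightarrow> 'a" where
  "letter w a = w ! nat (a mod int (length w))"

lemma letter_periodic: "letter w (a + int (length w)) = letter w a"
  by (simp add: letter_def)

lemma isum_letter: "isum (\<lambda>a. of_bool (letter w a = x)) (int (length w)) = int (count_list w x)"
  unfolding isum_eq_sum_nat count_list_eq_sum by (intro sum.cong) (simp_all add: letter_def)

lemma cyclic_shift_letters: "cyclic_shift (map (\<lambda>i. letter w (a + int i)) [0..<length w]) w"
proof (cases "w = []")
  case False
  have "map (\<lambda>i. letter w (a + int i)) [0..<length w] = rotate (nat (a mod int (length w))) w"
  proof (rule nth_equalityI)
    fix i assume "i < length (map (\<lambda>i. letter w (a + int i)) [0..<length w])"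
    moreover have "(a + int i) mod int (length w) =
        int ((nat (a mod int (length w)) + i) mod length w)"
      using False by (simp add: zmod_int mod_add_left_eq)
    ultimately show "map (\<lambda>i. letter w (a + int i)) [0..<length w] ! i =
        rotate (nat (a mod int (length w))) w ! i"
      by (simp add: letter_def nth_rotate)
  qed simp
  then show ?thesis unfolding cyclic_shift_def by blast
qed (simp add: cyclic_shift_def)

lemma length_step_list: "length w = count_list w StepD + count_list w StepE"
proof (induction w)
  case (Cons x w)
  then show ?case by (cases x) auto
qed simp

lemma length_costep_list: "length w = count_list w StepS + count_list w StepL"
proof (induction w)
  case (Cons x w)
  then show ?case by (cases x) auto
qed simp

theorem theorem3p11:
  fixes n \<alpha>\<^sub>S \<alpha>\<^sub>L \<beta>\<^sub>E \<beta>\<^sub>D :: nat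
    and W\<^sub>s :: "step list" and W\<^sub>c :: "costep list"
  assumes "n \<ge> 2"
    and "\<alpha>\<^sub>S + \<alpha>\<^sub>L > 0"
    and "\<beta>\<^sub>D = 2 * (\<alpha>\<^sub>S + \<alpha>\<^sub>L) - 1"
    and "count_list W\<^sub>s StepD = \<beta>\<^sub>D" and "count_list W\<^sub>s StepE = \<beta>\<^sub>E"
    and "count_list W\<^sub>c StepS = \<alpha>\<^sub>S" and "count_list W\<^sub>c StepL = \<alpha>\<^sub>L"
    and "2 * \<beta>\<^sub>E + 3 * \<alpha>\<^sub>S + 4 * \<alpha>\<^sub>L = n + 1"
  shows "\<exists>x \<in> indep_sets n.
           has_slither n (ticker_tape n x) W\<^sub>s \<and> has_coslither n (ticker_tape n x) W\<^sub>c"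
proof -
  define d :: "int \<Rightarrow> int" where "d = (\<lambda>a. of_bool (letter W\<^sub>s a = StepD))"
  define e :: "int \<Rightarrow> int" where "e = (\<lambda>b. of_bool (letter W\<^sub>c b = StepS))"
  have len_s: "length W\<^sub>s = \<beta>\<^sub>D + \<beta>\<^sub>E" and len_c: "length W\<^sub>c = \<alpha>\<^sub>S + \<alpha>\<^sub>L"
    using assms(4-7) length_step_list[of W\<^sub>s] length_costep_list[of W\<^sub>c] by simp_all
  have sums: "isum d (int (length W\<^sub>s)) = int \<beta>\<^sub>D" "isum e (int (length W\<^sub>c)) = int \<alpha>\<^sub>S"
    using assms(4,6) by (simp_all add: d_def e_def isum_letter)
  \<comment> \<open>The subtraction of naturals defining \<open>\<beta>\<^sub>D\<close> is exact
    because \<open>\<alpha>\<^sub>S + \<alpha>\<^sub>L\<close> is positive.\<close>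
  have "\<beta>\<^sub>D + 1 = 2 * (\<alpha>\<^sub>S + \<alpha>\<^sub>L)"
    using assms(2,3) by simp
  interpret feasible_pair n "length W\<^sub>c" "length W\<^sub>s" d e
  proof
    show "n \<ge> 2" "length W\<^sub>c > 0" "length W\<^sub>s > 0"
      using assms(1-3) len_s len_c by auto
    show "d a \<in> {0, 1}" "d (a + int (length W\<^sub>s)) = d a" for a
      by (simp_all add: d_def letter_periodic)
    show "e b \<in> {0, 1}" "e (b + int (length W\<^sub>c)) = e b" for b
      by (simp_all add: e_def letter_periodic)
    show "isum d (int (length W\<^sub>s)) = 2 * int (length W\<^sub>c) - 1"
      using sums(1) assms(2,3) len_c by simp
    \<comment> \<open>The left side is \<open>\<beta>\<^sub>D + 2 * \<beta>\<^sub>E +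
      \<alpha>\<^sub>S + 2 * \<alpha>\<^sub>L\<close>; substituting \<open>\<beta>\<^sub>D\<close>
      turns it into \<open>2 * \<beta>\<^sub>E + 3 * \<alpha>\<^sub>S + 4 * \<alpha>\<^sub>L -
      1\<close>.\<close>
    show "2 * int (length W\<^sub>s) - isum d (int (length W\<^sub>s)) + 2 * int (length W\<^sub>c)
        - isum e (int (length W\<^sub>c)) = int n"
      unfolding sums using \<open>\<beta>\<^sub>D + 1 = 2 * (\<alpha>\<^sub>S + \<alpha>\<^sub>L)\<close> assms(8) len_s len_c by simp
  qed
  have letter_s: "(if d a = 0 then StepE else StepD) = letter W\<^sub>s a" for a
    by (cases "letter W\<^sub>s a") (simp_all add: d_def)
  have letter_c: "(if e b = 1 then StepS else StepL) = letter W\<^sub>c b" for b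
    by (cases "letter W\<^sub>c b") (simp_all add: e_def)
  have nonempty: "positions \<noteq> {}"
    using position_in by blast
  have "has_slither n X W\<^sub>s"
    unfolding has_slither_def live_X
  proof (intro conjI nonempty ballI)
    fix k assume "k \<in> positions"
    then obtain a b where "k = position a b" unfolding positions_def by blast
    then show "cyclic_shift (slither_from n X k) W\<^sub>s"
      using cyclic_shift_letters[of W\<^sub>s a] by (simp only: slither_from_position letter_s)
  qed
  moreover have "has_coslither n X W\<^sub>c"
    unfolding has_coslither_def live_X
  proof (intro conjI nonempty ballI)
    fix k assume "k \<in> positions"
    then obtain a b where "k = position a b" unfolding positions_def by blast
    then show "cyclic_shift (coslither_from n X k) W\<^sub>c"
      using cyclic_shift_letters[of W\<^sub>c b] by (simp only: coslither_from_position letter_c)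
  qed
  \<comment> \<open>The witness is row 0, the window of the positions 1 to n.\<close>
  ultimately show ?thesis
    using window_in_indep_sets[of "int n"] unfolding ticker_tape_window[symmetric] by blast
qed

end
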